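(* Let $P$ be a finite poset, let $P=A\sqcup B$ be an admissible cut, and let $P^-$ be the associated negative poset, with order $\leq_-$. Then, in $P^-$, $B$ is an ideal and $A$ is a filter. For every $a\in A$, set $L_B^-(a)=\{b\in B: b\leq_- a\}$. Then $$M(a)=\operatorname{Max}_B(L_B^-(a)),$$ where $\operatorname{Max}_B(C)$ denotes the set of maximal elements of $C\subseteq B$ with respect to $\leq_B$. Consequently, the original poset $P$ is uniquely determined by $P^-$ together with the partition $A\sqcup B$. More precisely, the orders induced on $A$ and $B$ are unchanged (i.e. $P$ and $P^-$ induce the same orders on $A$ and on $B$), and, for every $a\in A$ and $b\in B$, $$a\leq_P b \iff \text{there exists } m\in\operatorname{Max}_B(L_B^-(a))\text{ such that } m\leq_B b.$$
   Context: Ideal means downward closed subset, filter means upward closed subset. Let $P$ be a finite poset with a partition $P=A\sqcup B$ of its underlying set, with induced orders $\leq_A,\leq_B$. For $b\in B$ put $[b,\bullet]_B=\{b'\in B: b\leq_B b'\}$ and $[\bullet,b]_B=\{b'\in B: b'\leq_B b\}$. For $a\in A$ let $U_B(a)=\{b\in B: a\leq_P b\}$ and let $M(a)$ be the set of minimal elements of $U_B(a)$ with respect to $\leq_B$. The partition is an admissible cut if: (a) $A$ is an ideal of $P$ and $B$ is a filter of $P$; (b) for every $a\in A$ and all distinct $m,m'\in M(a)$: $[m,\bullet]_B\cap[m',\bullet]_B=\emptyset$ and $[\bullet,m]_B\cap[\bullet,m']_B=\emptyset$; (c) for all $a\leq_A a'$ in $A$ and every $m\in M(a)$ there exists $m'\in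 M(a')$ with $m\leq_B m'$. For an admissible cut $P=A\sqcup B$, the associated negative poset $P^-$ is the set $A\sqcup B$ with the partial order $\leq_-$ that restricts to $\leq_A$ on $A$ and $\leq_B$ on $B$ and whose only relations between elements of $A$ and $B$ are: for $a\in A$, $b\in B$, $b\leq_- a$ if and only if there exists $m\in M(a)$ with $b\leq_B m$ (so $a\leq_- b$ never holds). *)

theory Defs
  imports Main
begin

text \<open>
  A poset is a carrier set P with a relation r such that partial_order_on P r.  The order induced
  on a subset B is \<open>Restr r B\<close>; accordingly the principal up-set and down-set of b in B are
  \<open>above (Restr r B) b\<close> and \<open>under (Restr r B) b\<close>.
\<close>

definition order_ideal :: "'a set \<Rightarrow> 'a rel \<Rightarrow> 'a set \<Rightarrow> bool" where
  "order_ideal P r I \<longleftrightarrow> I \<subseteq> P \<and> (\<forall>x\<in>I. \<forall>y\<in>P. (y, x) \<in> r \<longrightarrow> y \<in> I)"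

definition order_filter :: "'a set \<Rightarrow> 'a rel \<Rightarrow> 'a set \<Rightarrow> bool" where
  "order_filter P r F \<longleftrightarrow> F \<subseteq> P \<and> (\<forall>x\<in>F. \<forall>y\<in>P. (x, y) \<in> r \<longrightarrow> y \<in> F)"

definition min_elements :: "'a rel \<Rightarrow> 'a set \<Rightarrow> 'a set" where
  "min_elements r C = {x \<in> C. \<forall>y\<in>C. (y, x) \<in> r \<longrightarrow> y = x}"

definition max_elements :: "'a rel \<Rightarrow> 'a set \<Rightarrow> 'a set" where
  "max_elements r C = {x \<in> C. \<forall>y\<in>C. (x, y) \<in> r \<longrightarrow> y = x}"

definition upper_part :: "'a rel \<Rightarrow> 'a set \<Rightarrow> 'a \<Rightarrow> 'a set" where
  "upper_part r B a = {b \<in> B. (a, b) \<in> r}"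

definition lower_part :: "'a rel \<Rightarrow> 'a set \<Rightarrow> 'a \<Rightarrow> 'a set" where
  "lower_part r B a = {b \<in> B. (b, a) \<in> r}"

definition min_upper :: "'a rel \<Rightarrow> 'a set \<Rightarrow> 'a \<Rightarrow> 'a set" where
  "min_upper r B a = min_elements (Restr r B) (upper_part r B a)"

definition admissible_cut :: "'a set \<Rightarrow> 'a rel \<Rightarrow> 'a set \<Rightarrow> 'a set \<Rightarrow> bool" where
  "admissible_cut P r A B \<longleftrightarrow>
     A \<union> B = P \<and> A \<inter> B = {} \<and>
     order_ideal P r A \<and> order_filter P r B \<and>
     (\<forall>a\<in>A. \<forall>m\<in>min_upper r B a. \<forall>m'\<in>min_upper r B a. m \<noteq> m' \<longrightarrow>
        above (Restr r B) m \<inter> above (Restr r B) m' = {} \<and>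
        under (Restr r B) m \<inter> under (Restr r B) m' = {}) \<and>
     (\<forall>a\<in>A. \<forall>a'\<in>A. (a, a') \<in> Restr r A \<longrightarrow>
        (\<forall>m\<in>min_upper r B a. \<exists>m'\<in>min_upper r B a'. (m, m') \<in> Restr r B))"

definition negative_order :: "'a rel \<Rightarrow> 'a set \<Rightarrow> 'a set \<Rightarrow> 'a rel" where
  "negative_order r A B = Restr r A \<union> Restr r B \<union>
     {(b, a). b \<in> B \<and> a \<in> A \<and> (\<exists>m\<in>min_upper r B a. (b, m) \<in> Restr r B)}"

text \<open>Well-definedness of the negative poset.\<close>

lemma partial_order_on_negative_order:
  assumes po: "partial_order_on P r" and cut: "admissible_cut P r A B"
  shows "partial_order_on P (negative_order r A B)"
proof -
  have P: "P = A \<union> B" and AB: "A \<inter> B = {}"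
    using cut by (auto simp: admissible_cut_def)
  have c: "\<exists>m'\<in>min_upper r B a'. (m, m') \<in> Restr r B"
    if "a \<in> A" "a' \<in> A" "(a, a') \<in> r" "m \<in> min_upper r B a" for a a' m
    using cut that unfolding admissible_cut_def by blast
  have rf: "\<And>x. x \<in> P \<Longrightarrow> (x, x) \<in> r" and tr: "\<And>x y z. (x, y) \<in> r \<Longrightarrow> (y, z) \<in> r \<Longrightarrow> (x, z) \<in> r"
    and an: "\<And>x y. (x, y) \<in> r \<Longrightarrow> (y, x) \<in> r \<Longrightarrow> x = y"
    using po unfolding partial_order_on_def preorder_on_def refl_on_def trans_def antisym_def
    by blast+
  have "negative_order r A B \<subseteq> P \<times> P"
    using P by (auto simp: negative_order_def)
  moreover have "refl_on P (negative_order r A B)"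
    using P rf calculation by (auto simp: negative_order_def refl_on_def)
  moreover have "antisym (negative_order r A B)"
    using AB an by (auto simp: negative_order_def antisym_def)
  moreover have "trans (negative_order r A B)"
  proof (rule transI)
    fix x y z
    assume xy: "(x, y) \<in> negative_order r A B" and yz: "(y, z) \<in> negative_order r A B"
    show "(x, z) \<in> negative_order r A B"
    proof (cases "x \<in> B \<and> y \<in> A \<and> z \<in> A")
      case True
      then obtain m where m: "m \<in> min_upper r B y" "(x, m) \<in> r" "m \<in> B"
        using xy AB by (auto simp: negative_order_def)
      have "(y, z) \<in> r" using True yz AB by (auto simp: negative_order_def)
      then obtain m' where "m' \<in> min_upper r B z" "(m, m') \<in> Restr r B"
        using c True m by blast
      then show ?thesis
        using True m tr by (auto simp: negative_order_def)
    next
      case False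
      then show ?thesis
        using xy yz AB tr unfolding negative_order_def by blast
    qed
  qed
  ultimately show ?thesis
    by (simp add: partial_order_on_def preorder_on_def)
qed

end

theory Submission
  imports Defs
begin

text \<open>
  In a finite poset an upper set is determined by its minimal elements, and an antichain is
  determined by its down-closure, as the set of maximal elements of it. For \<open>a\<close> in \<open>A\<close>, the part
  of \<open>B\<close> above \<open>a\<close> in the original order is the up-closure of the antichain \<open>min_upper r B a\<close>
  in \<open>B\<close>, while the part of \<open>B\<close> below \<open>a\<close> in the negative order is by construction the
  down-closure of the same antichain. So \<open>min_upper r B a\<close> can be recovered from the negative
  order (\<open>min_upper_eq_max_lower_part\<close>), and its up-closure gives back the relations from \<open>a\<close>
  to \<open>B\<close> (\<open>rel_iff_above_min_upper\<close>).

  The relations inside \<open>A\<close> and inside \<open>B\<close> are untouched by the construction, and in the original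
  poset nothing in \<open>B\<close> lies below anything in \<open>A\<close>. Every pair of the original order can therefore
  be read off from the negative order and the partition (\<open>order_eq_from_negative_order\<close>), which
  is the uniqueness claim.
\<close>

lemma min_element_below:
  assumes "trans r" "antisym r" "finite C" "x \<in> C" "(x, x) \<in> r"
  shows "\<exists>m\<in>min_elements r C. (m, x) \<in> r"
proof -
  let ?D = "{y \<in> C. (y, x) \<in> r}"
  let ?R = "\<lambda>y z. (y, z) \<in> r \<and> y \<noteq> z"
  have "asymp_on ?D ?R"
    using \<open>antisym r\<close> by (auto simp: asymp_on_def antisym_def)
  moreover have "transp_on ?D ?R"
    using \<open>trans r\<close> \<open>antisym r\<close> unfolding transp_on_def trans_def antisym_def by blast
  moreover have "finite ?D" "?D \<noteq> {}"
    using assms by auto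
  ultimately obtain m where "m \<in> ?D" "\<forall>y\<in>?D. y \<noteq> m \<longrightarrow> \<not> ?R y m"
    using Finite_Set.bex_min_element[of ?D ?R] by blast
  then show ?thesis
    using \<open>trans r\<close> unfolding min_elements_def trans_def by blast
qed

text \<open>
  A member of the down-closure of an antichain \<open>M\<close> lies below some \<open>m\<close> in \<open>M\<close>, so it is maximal
  only if it equals \<open>m\<close>; conversely, anything above \<open>m\<close> in the down-closure lies below some \<open>m'\<close>
  in \<open>M\<close>, and the antichain property squeezes it between \<open>m\<close> and \<open>m' = m\<close>.
\<close>

lemma max_elements_down_closure_antichain:
  assumes "trans r" "antisym r" "refl_on M r"
    and antichain: "\<And>m m'. m \<in> M \<Longrightarrow> m' \<in> M \<Longrightarrow> (m, m') \<in> r \<Longrightarrow> m = m'"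
  shows "max_elements r {x. \<exists>m\<in>M. (x, m) \<in> r} = M" (is "max_elements r ?D = M")
proof
  have MD: "M \<subseteq> ?D"
    using \<open>refl_on M r\<close> by (auto simp: refl_on_def)
  then show "max_elements r ?D \<subseteq> M"
    unfolding max_elements_def by blast
  show "M \<subseteq> max_elements r ?D"
  proof
    fix m assume m: "m \<in> M"
    have "y = m" if y: "y \<in> ?D" "(m, y) \<in> r" for y
    proof -
      obtain m' where m': "m' \<in> M" "(y, m') \<in> r"
        using y by blast
      then have "m = m'"
        using antichain m y \<open>trans r\<close> by (meson transD)
      then show "y = m"
        using m' y \<open>antisym r\<close> by (simp add: antisymD)
    qed
    then show "m \<in> max_elements r ?D"
      using m MD unfolding max_elements_def by blast
  qed
qed

lemma partial_order_on_Restr: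
  assumes "partial_order_on P r" "B \<subseteq> P"
  shows "trans (Restr r B)" "antisym (Restr r B)" "refl_on B (Restr r B)"
  using assms
  unfolding partial_order_on_def preorder_on_def refl_on_def trans_def antisym_def by blast+

lemma rel_iff_above_min_upper:
  assumes "finite B" and po: "partial_order_on P r" and "B \<subseteq> P" and b: "b \<in> B"
  shows "(a, b) \<in> r \<longleftrightarrow> (\<exists>m\<in>min_upper r B a. (m, b) \<in> Restr r B)"
proof
  assume "(a, b) \<in> r"
  then have "b \<in> upper_part r B a"
    using b by (simp add: upper_part_def)
  moreover have "finite (upper_part r B a)"
    using \<open>finite B\<close> by (simp add: upper_part_def)
  moreover have "(b, b) \<in> Restr r B"
    using partial_order_on_Restr(3)[OF po \<open>B \<subseteq> P\<close>] b unfolding refl_on_def by blast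
  ultimately show "\<exists>m\<in>min_upper r B a. (m, b) \<in> Restr r B"
    unfolding min_upper_def
    by (intro min_element_below partial_order_on_Restr[OF po \<open>B \<subseteq> P\<close>])
next
  assume "\<exists>m\<in>min_upper r B a. (m, b) \<in> Restr r B"
  then obtain m where "(a, m) \<in> r" "(m, b) \<in> r"
    by (auto simp: min_upper_def min_elements_def upper_part_def)
  then show "(a, b) \<in> r"
    using po unfolding partial_order_on_def preorder_on_def by (meson transD)
qed

lemma min_upper_eq_max_lower_part:
  assumes po: "partial_order_on P r" and "B \<subseteq> P" and "A \<inter> B = {}" and "a \<in> A"
  shows "min_upper r B a
    = max_elements (Restr r B) (lower_part (negative_order r A B) B a)"
proof -
  note B = partial_order_on_Restr[OF po \<open>B \<subseteq> P\<close>]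
  have sub: "min_upper r B a \<subseteq> B"
    by (auto simp: min_upper_def min_elements_def upper_part_def)
  have "lower_part (negative_order r A B) B a = {x. \<exists>m\<in>min_upper r B a. (x, m) \<in> Restr r B}"
    using \<open>A \<inter> B = {}\<close> \<open>a \<in> A\<close> by (auto simp: lower_part_def negative_order_def)
  moreover have "refl_on (min_upper r B a) (Restr r B)"
    using B(3) sub unfolding refl_on_def by blast
  moreover have "m = m'"
    if "m \<in> min_upper r B a" "m' \<in> min_upper r B a" "(m, m') \<in> Restr r B" for m m'
    using that by (auto simp: min_upper_def min_elements_def)
  ultimately show ?thesis
    using max_elements_down_closure_antichain[OF B(1,2)] by simp
qed

lemma Restr_negative_order:
  assumes "A \<inter> B = {}"
  shows "Restr (negative_order r A B) A = Restr r A"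
    and "Restr (negative_order r A B) B = Restr r B"
  using assms by (auto simp: negative_order_def)

text \<open>
  The right-hand side mentions \<open>r\<close> only through its negative order, so two posets with the same
  cut and the same negative order coincide.
\<close>

lemma order_eq_from_negative_order:
  fixes A B :: "'a set"
  assumes "finite P" and po: "partial_order_on P r" and cut: "admissible_cut P r A B"
  defines "n \<equiv> negative_order r A B"
  shows "r = Restr n A \<union> Restr n B \<union>
    {(a, b). a \<in> A \<and> b \<in> B \<and>
       (\<exists>m\<in>max_elements (Restr n B) (lower_part n B a). (m, b) \<in> Restr n B)}"
    (is "r = _ \<union> _ \<union> ?up")
proof -
  have P: "A \<union> B = P" and AB: "A \<inter> B = {}" and ideal: "order_ideal P r A"
    using cut by (auto simp: admissible_cut_def)
  have "finite B" "B \<subseteq> P"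
    using P \<open>finite P\<close> by auto
  have "(a, b) \<in> ?up \<longleftrightarrow> (a, b) \<in> r" if "a \<in> A" "b \<in> B" for a b
    using that rel_iff_above_min_upper[OF \<open>finite B\<close> po \<open>B \<subseteq> P\<close> \<open>b \<in> B\<close>, of a]
    unfolding n_def Restr_negative_order[OF AB]
      min_upper_eq_max_lower_part[OF po \<open>B \<subseteq> P\<close> AB \<open>a \<in> A\<close>] by blast
  then have "?up = r \<inter> A \<times> B"
    by blast
  moreover have "r = Restr r A \<union> Restr r B \<union> r \<inter> A \<times> B"
  proof -
    have "r \<subseteq> P \<times> P"
      using po by (simp add: partial_order_on_def preorder_on_def)
    moreover have "r \<inter> B \<times> A = {}"
      using ideal AB P unfolding order_ideal_def by blast
    ultimately show ?thesis
      using P by blast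
  qed
  ultimately show ?thesis
    unfolding n_def Restr_negative_order[OF AB] by argo
qed

theorem proposition3p4:
  fixes P A B :: "'a set" and r :: "'a rel"
  assumes "finite P"
    and "partial_order_on P r"
    and "admissible_cut P r A B"
  shows
    "order_ideal P (negative_order r A B) B \<and>
     order_filter P (negative_order r A B) A \<and>
     (\<forall>a\<in>A. min_upper r B a =
        max_elements (Restr r B) (lower_part (negative_order r A B) B a)) \<and>
     (\<forall>P' r'. finite P' \<longrightarrow> partial_order_on P' r' \<longrightarrow> admissible_cut P' r' A B \<longrightarrow>
        negative_order r' A B = negative_order r A B \<longrightarrow> P' = P \<and> r' = r) \<and>
     Restr (negative_order r A B) A = Restr r A \<and>
     Restr (negative_order r A B) B = Restr r B \<and>
     (\<forall>a\<in>A. \<forall>b\<in>B. (a, b) \<in> r \<longleftrightarrow>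
        (\<exists>m\<in>max_elements (Restr r B) (lower_part (negative_order r A B) B a).
           (m, b) \<in> Restr r B))"
proof (intro conjI)
  have P: "A \<union> B = P" and AB: "A \<inter> B = {}"
    using assms(3) by (auto simp: admissible_cut_def)
  have "finite B" "B \<subseteq> P"
    using P \<open>finite P\<close> by auto
  show "order_ideal P (negative_order r A B) B" "order_filter P (negative_order r A B) A"
    using P AB by (auto simp: order_ideal_def order_filter_def negative_order_def)
  show max: "\<forall>a\<in>A. min_upper r B a =
      max_elements (Restr r B) (lower_part (negative_order r A B) B a)"
    using min_upper_eq_max_lower_part[OF assms(2) \<open>B \<subseteq> P\<close> AB] by blast
  show "\<forall>P' r'. finite P' \<longrightarrow> partial_order_on P' r' \<longrightarrow> admissible_cut P' r' A B \<longrightarrow>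
      negative_order r' A B = negative_order r A B \<longrightarrow> P' = P \<and> r' = r"
  proof (intro allI impI conjI)
    fix P' r'
    assume *: "finite P'" "partial_order_on P' r'" "admissible_cut P' r' A B"
      and eq: "negative_order r' A B = negative_order r A B"
    show "P' = P"
      using *(3) P by (simp add: admissible_cut_def)
    show "r' = r"
      using order_eq_from_negative_order[OF *] order_eq_from_negative_order[OF assms]
      unfolding eq by simp
  qed
  show "Restr (negative_order r A B) A = Restr r A" "Restr (negative_order r A B) B = Restr r B"
    using Restr_negative_order[OF AB] by blast+
  show "\<forall>a\<in>A. \<forall>b\<in>B. (a, b) \<in> r \<longleftrightarrow>
      (\<exists>m\<in>max_elements (Restr r B) (lower_part (negative_order r A B) B a).
         (m, b) \<in> Restr r B)"
    using max rel_iff_above_min_upper[OF \<open>finite B\<close> assms(2) \<open>B \<subseteq> P\<close>] by metis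
qed

end
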